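(* For every integer $n\ge 3$, the cycle $C_n$ satisfies $E_{\mathrm{ISI}}(C_n)=E(C_n)$.
   Context: $C_n$ is the cycle graph on $n$ vertices. For a simple graph $G$ with vertices $v_1,\dots,v_n$, let $d_i$ be the degree of $v_i$. The ISI matrix $S(G)=[s_{ij}]_{n\times n}$ has $s_{ij}=\frac{d_id_j}{d_i+d_j}$ if $v_i$ and $v_j$ are adjacent and $s_{ij}=0$ otherwise. The ISI energy is $E_{\mathrm{ISI}}(G)=\sum_{i=1}^n|\tau_i|$, where $\tau_1,\dots,\tau_n$ are the eigenvalues of $S(G)$ counted with multiplicity. The energy is $E(G)=\sum_{i=1}^n|\lambda_i|$, where $\lambda_1,\dots,\lambda_n$ are the eigenvalues of the adjacency matrix $A(G)$ counted with multiplicity. *)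

theory Defs
  imports
    "Jordan_Normal_Form.Char_Poly"
    "Graph_Theory.Pair_Digraph"
    "HOL-Computational_Algebra.Fundamental_Theorem_Algebra"
begin

text \<open>
  A finite simple graph is a \<open>pair_graph\<close>, i.e. a finite loop-free symmetric digraph
  without parallel arcs: an edge \<open>uv\<close> is the pair of arcs \<open>(u,v)\<close> and \<open>(v,u)\<close>, so the degree
  of a vertex is its out-degree.
\<close>

abbreviation degree_of :: "'a pair_pre_digraph \<Rightarrow> 'a \<Rightarrow> nat" where
  "degree_of G v \<equiv> out_degree (with_proj G) v"

text \<open>\<open>vs\<close> is the enumeration \<open>v\<^sub>1, \<dots>, v\<^sub>n\<close> of the vertices that indexes the matrices.\<close>

definition enumerates :: "'a list \<Rightarrow> 'a pair_pre_digraph \<Rightarrow> bool" where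
  "enumerates vs G \<longleftrightarrow> distinct vs \<and> set vs = pverts G"

definition vertex_mat :: "('a \<Rightarrow> 'a \<Rightarrow> real) \<Rightarrow> 'a list \<Rightarrow> real mat" where
  "vertex_mat w vs = mat (length vs) (length vs) (\<lambda>(i, j). w (vs ! i) (vs ! j))"

definition adjacency_mat :: "'a pair_pre_digraph \<Rightarrow> 'a list \<Rightarrow> real mat" where
  "adjacency_mat G = vertex_mat (\<lambda>u v. if (u, v) \<in> parcs G then 1 else 0)"

definition isi_mat :: "'a pair_pre_digraph \<Rightarrow> 'a list \<Rightarrow> real mat" where
  "isi_mat G = vertex_mat (\<lambda>u v. if (u, v) \<in> parcs G
     then real (degree_of G u) * real (degree_of G v) / (real (degree_of G u) + real (degree_of G v))
     else 0)"

text \<open>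
  The eigenvalues with algebraic multiplicity, taken in \<open>\<complex>\<close>, so that an \<open>n \<times> n\<close> matrix
  has exactly \<open>n\<close> of them. For the symmetric matrices above they are all real, and the
  algebraic and geometric multiplicities agree.
\<close>

definition eigenvalue_mset :: "real mat \<Rightarrow> complex multiset" where
  "eigenvalue_mset A = proots (char_poly (map_mat complex_of_real A))"

lemma size_eigenvalue_mset: "A \<in> carrier_mat n n \<Longrightarrow> size (eigenvalue_mset A) = n"
  by (simp add: eigenvalue_mset_def size_proots_complex degree_monic_char_poly)

lemma set_eigenvalue_mset:
  assumes "A \<in> carrier_mat n n"
  shows "set_mset (eigenvalue_mset A) = {\<tau>. eigenvalue (map_mat complex_of_real A) \<tau>}"
proof -
  have A: "map_mat complex_of_real A \<in> carrier_mat n n" using assms by simp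
  have "char_poly (map_mat complex_of_real A) \<noteq> 0"
    using degree_monic_char_poly[OF A] by (metis coeff_0 zero_neq_one)
  then show ?thesis
    by (simp add: eigenvalue_mset_def eigenvalue_root_char_poly[OF A])
qed

definition mat_energy :: "real mat \<Rightarrow> real" where
  "mat_energy A = (\<Sum>\<tau>\<in>#eigenvalue_mset A. cmod \<tau>)"

text \<open>
  The choice of the enumeration is immaterial, see \<open>energy_eq\<close> and \<open>isi_energy_eq\<close>.
\<close>

definition energy :: "'a pair_pre_digraph \<Rightarrow> real" where
  "energy G = mat_energy (adjacency_mat G (SOME vs. enumerates vs G))"

definition isi_energy :: "'a pair_pre_digraph \<Rightarrow> real" where
  "isi_energy G = mat_energy (isi_mat G (SOME vs. enumerates vs G))"

lemma sum_indicator_nth: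
  fixes f :: "nat \<Rightarrow> 'b::semiring_1"
  assumes "distinct ws" "k < length ws"
  shows "(\<Sum>i\<in>{0..<length ws}. (if ws ! k = ws ! i then 1 else 0) * f i) = f k" (is "?L = _")
    and "(\<Sum>i\<in>{0..<length ws}. f i * (if ws ! i = ws ! k then 1 else 0)) = f k" (is "?R = _")
proof -
  have "?L = (\<Sum>i\<in>{0..<length ws}. if i = k then f i else 0)"
    using assms by (intro sum.cong) (auto simp: nth_eq_iff_index_eq)
  also have "\<dots> = f k" using assms(2) by simp
  finally show "?L = f k" .
  have "?R = (\<Sum>i\<in>{0..<length ws}. if i = k then f i else 0)"
    using assms by (intro sum.cong) (auto simp: nth_eq_iff_index_eq)
  also have "\<dots> = f k" using assms(2) by simp
  finally show "?R = f k" .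
qed

lemma similar_vertex_mat:
  assumes "distinct vs" "distinct ws" "set vs = set ws"
  shows "similar_mat (map_mat complex_of_real (vertex_mat w vs)) (map_mat complex_of_real (vertex_mat w ws))"
proof -
  define n where "n = length vs"
  have len: "length vs = n" "length ws = n"
    using assms distinct_card n_def by metis+
  define P where "P = (\<lambda>xs ys. mat n n (\<lambda>(i, j). if (xs :: 'a list) ! i = ys ! j then 1 else (0::complex)))"
  have index: "\<exists>k<n. xs ! i = ys ! k"
    if "set xs = set ys" "length xs = n" "length ys = n" "i < n" for xs ys :: "'a list" and i
    using that by (metis in_set_conv_nth)
  have P1: "P xs ys * P ys xs = 1\<^sub>m n"
    if *: "set xs = set ys" "distinct xs" "distinct ys" "length xs = n" "length ys = n" for xs ys
  proof (rule eq_matI)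
    fix i j assume ij: "i < dim_row (1\<^sub>m n :: complex mat)" "j < dim_col (1\<^sub>m n :: complex mat)"
    then obtain k where k: "k < n" "xs ! i = ys ! k" using index * by (metis index_one_mat(2))
    have "(P xs ys * P ys xs) $$ (i, j)
        = (\<Sum>l\<in>{0..<n}. (if ys ! k = ys ! l then 1 else 0) * (if ys ! l = xs ! j then 1 else 0))"
      using ij k by (simp add: P_def scalar_prod_def)
    also have "\<dots> = (if ys ! k = xs ! j then 1 else 0)"
      using sum_indicator_nth(1)[of ys k "\<lambda>l. if ys ! l = xs ! j then 1 else 0"] * k by simp
    also have "\<dots> = (1\<^sub>m n :: complex mat) $$ (i, j)"
      using ij * k(2)[symmetric] by (simp add: nth_eq_iff_index_eq)
    finally show "(P xs ys * P ys xs) $$ (i, j) = (1\<^sub>m n :: complex mat) $$ (i, j)" .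
  qed (simp_all add: P_def)
  let ?B = "map_mat complex_of_real (vertex_mat w ws)"
  have BC: "?B \<in> carrier_mat n n" "P vs ws \<in> carrier_mat n n" "P ws vs \<in> carrier_mat n n"
    by (simp_all add: vertex_mat_def len P_def)
  have "map_mat complex_of_real (vertex_mat w vs) = P vs ws * ?B * P ws vs"
  proof (rule eq_matI)
    fix i j assume "i < dim_row (P vs ws * ?B * P ws vs)" "j < dim_col (P vs ws * ?B * P ws vs)"
    then have ij: "i < n" "j < n" by (simp_all add: P_def)
    obtain k where k: "k < n" "vs ! i = ws ! k" using index assms len ij by metis
    obtain l where l: "l < n" "vs ! j = ws ! l" using index assms len ij by metis
    have PB: "(P vs ws * ?B) $$ (i, m) = of_real (w (ws ! k) (ws ! m))" if "m < n" for m
    proof -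
      have "(P vs ws * ?B) $$ (i, m)
          = (\<Sum>q\<in>{0..<n}. (if ws ! k = ws ! q then 1 else 0) * of_real (w (ws ! q) (ws ! m)))"
        using ij k that len by (simp add: P_def vertex_mat_def scalar_prod_def)
      then show ?thesis
        using sum_indicator_nth(1)[of ws k "\<lambda>q. of_real (w (ws ! q) (ws ! m)) :: complex"] assms k len
        by simp
    qed
    have "(P vs ws * ?B * P ws vs) $$ (i, j) = (\<Sum>m\<in>{0..<n}. (P vs ws * ?B) $$ (i, m) * P ws vs $$ (m, j))"
      using ij BC by (subst index_mult_mat(1)) (auto simp: scalar_prod_def simp del: assoc_mult_mat)
    also have "\<dots> = (\<Sum>m\<in>{0..<n}. of_real (w (ws ! k) (ws ! m)) * (if ws ! m = ws ! l then 1 else 0))"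
      using ij l by (intro sum.cong) (simp_all add: PB, simp add: P_def)
    also have "\<dots> = of_real (w (ws ! k) (ws ! l))"
      using sum_indicator_nth(2)[of ws l "\<lambda>m. of_real (w (ws ! k) (ws ! m)) :: complex"] assms l len
      by simp
    finally show "map_mat complex_of_real (vertex_mat w vs) $$ (i, j) = (P vs ws * ?B * P ws vs) $$ (i, j)"
      using ij k l len by (simp add: vertex_mat_def)
  qed (simp_all add: P_def vertex_mat_def len)
  then show ?thesis
    using P1 assms len BC
    by (intro similar_matI[of _ _ "P vs ws" "P ws vs" n]) (auto simp: vertex_mat_def)
qed

lemma mat_energy_vertex_mat_cong:
  assumes "enumerates vs G" "enumerates ws G"
  shows "mat_energy (vertex_mat w vs) = mat_energy (vertex_mat w ws)"
  using char_poly_similar[OF similar_vertex_mat, of vs ws w] assms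
  by (simp add: mat_energy_def eigenvalue_mset_def enumerates_def)

lemma energy_eq: "enumerates vs G \<Longrightarrow> energy G = mat_energy (adjacency_mat G vs)"
  unfolding energy_def adjacency_mat_def
  by (rule mat_energy_vertex_mat_cong[OF someI[where P = "\<lambda>vs. enumerates vs G"]])

lemma isi_energy_eq: "enumerates vs G \<Longrightarrow> isi_energy G = mat_energy (isi_mat G vs)"
  unfolding isi_energy_def isi_mat_def
  by (rule mat_energy_vertex_mat_cong[OF someI[where P = "\<lambda>vs. enumerates vs G"]])

definition cycle_graph :: "nat \<Rightarrow> nat pair_pre_digraph" where
  "cycle_graph n = \<lparr> pverts = {0..<n},
     parcs = {(i, j). i < n \<and> j < n \<and> (j = (i + 1) mod n \<or> i = (j + 1) mod n)} \<rparr>"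

lemma pair_graph_cycle_graph:
  assumes "n \<ge> 3"
  shows "pair_graph (cycle_graph n)"
proof
  have "parcs (cycle_graph n) \<subseteq> {0..<n} \<times> {0..<n}" by (auto simp: cycle_graph_def)
  then show "finite (parcs (cycle_graph n))" by (rule finite_subset) simp
  show "symmetric (with_proj (cycle_graph n))"
    by (auto simp: symmetric_def cycle_graph_def intro!: symI)
  have "(i + 1) mod n \<noteq> i" if "i < n" for i
    using that assms by (cases "i + 1 = n") auto
  then show "fst e \<noteq> snd e" if "e \<in> parcs (cycle_graph n)" for e
    using that by (fastforce simp: cycle_graph_def)
qed (auto simp: cycle_graph_def)

end

theory Submission
  imports Defs
begin

text \<open>Every vertex of a cycle has degree 2 (\<open>degree_of_cycle_graph\<close>), so each
  edge has ISI weight 2*2/(2+2) = 1. The ISI matrix is therefore the adjacency matrix itself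
  (\<open>isi_mat_eq_adjacency_mat\<close>), and no eigenvalue has to be computed.\<close>

lemma degree_of_cycle_graph:
  assumes "n \<ge> 3" "v < n"
  shows "degree_of (cycle_graph n) v = 2"
proof -
  let ?p = "if v = 0 then n - 1 else v - 1"
  let ?s = "if v = n - 1 then 0 else v + 1"
  \<comment> \<open>Without \<open>mod\<close>, wrap-around is a case split at \<open>n - 1\<close>,
    and \<open>v = (j + 1) mod n\<close> can be solved for \<open>j\<close>, giving the cyclic
    predecessor \<open>?p\<close>.\<close>
  have succ: "(i + 1) mod n = (if i = n - 1 then 0 else i + 1)" if "i < n" for i
    using that by auto
  have arc: "(j = (v + 1) mod n \<or> v = (j + 1) mod n) \<longleftrightarrow> j = ?s \<or> j = ?p" if "j < n" for j
    unfolding succ[OF assms(2)] succ[OF that] using assms that by auto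
  have "out_arcs (with_proj (cycle_graph n)) v
      = {v} \<times> {j. j < n \<and> (j = (v + 1) mod n \<or> v = (j + 1) mod n)}"
    using assms(2) by (auto simp: out_arcs_def cycle_graph_def)
  also have "{j. j < n \<and> (j = (v + 1) mod n \<or> v = (j + 1) mod n)} = {j. j < n \<and> (j = ?s \<or> j = ?p)}"
    using arc by blast
  also have "\<dots> = {?s, ?p}"
    using assms by auto
  finally have "out_arcs (with_proj (cycle_graph n)) v = {v} \<times> {?s, ?p}" .
  \<comment> \<open>Here \<open>n \<ge> 3\<close> is essential: for n = 2 both neighbours
    coincide.\<close>
  moreover have "?s \<noteq> ?p"
    using assms by auto
  ultimately show ?thesis
    by (simp add: out_degree_def card_cartesian_product)
qed

text \<open>Only endpoints of arcs matter, since both matrices vanish off the arcs. The equality is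
  between functions of the enumeration.\<close>

lemma isi_mat_eq_adjacency_mat:
  assumes "\<And>u v. (u, v) \<in> parcs G \<Longrightarrow> degree_of G u = 2 \<and> degree_of G v = 2"
  shows "isi_mat G = adjacency_mat G"
proof -
  have "(\<lambda>u v. if (u, v) \<in> parcs G
      then real (degree_of G u) * real (degree_of G v) / (real (degree_of G u) + real (degree_of G v))
      else 0) = (\<lambda>u v. if (u, v) \<in> parcs G then 1 else 0)"
    using assms by (intro ext) simp
  then show ?thesis
    by (simp only: isi_mat_def adjacency_mat_def)
qed

theorem theorem3p1:
  fixes n :: nat
  assumes "n \<ge> 3"
  shows "isi_energy (cycle_graph n) = energy (cycle_graph n)"
proof -
  have "isi_mat (cycle_graph n) = adjacency_mat (cycle_graph n)"
  proof (rule isi_mat_eq_adjacency_mat)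
    fix u v assume "(u, v) \<in> parcs (cycle_graph n)"
    then have "u < n" "v < n"
      by (auto simp: cycle_graph_def)
    then show "degree_of (cycle_graph n) u = 2 \<and> degree_of (cycle_graph n) v = 2"
      using degree_of_cycle_graph[OF assms] by blast
  qed
  \<comment> \<open>Both energies use the same \<open>SOME\<close> enumeration, so unfolding
    suffices.\<close>
  then show ?thesis
    by (simp add: isi_energy_def energy_def)
qed

end
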